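(* Let $b_1,b_2,\ldots,b_k$ be rational integers and let $\mu_1,\mu_2,\ldots,\mu_k$ be pairwise relatively prime Gaussian integers. Then there are infinitely many primitive Gaussian lines $L$ such that $\mu_j$ divides the Gaussian integer $\alpha_{b_j}$ on $L$ for all $1\le j\le k$.
   Context: A Gaussian line is a line in the complex plane containing at least two (hence infinitely many) elements of $\mathbb{Z}[i]$. It is primitive if the Gaussian integers on it do not all share a common non-unit divisor in $\mathbb{Z}[i]$. For a Gaussian line $L$, $\alpha_0=a+bi$ denotes the Gaussian integer on $L$ of minimum norm $N(x+iy)=x^2+y^2$ (if there are two, the one with larger real part). If $L$ is vertical, $\delta=i$; otherwise $\delta=c+di=\alpha_1-\alpha_0$, where $\alpha_1$ is the Gaussian integer on $L$ closest to $\alpha_0$ with $\mathrm{Re}(\alpha_1)>\mathrm{Re}(\alpha_0)$. Then the Gaussian integers on $L$ are exactly $\alpha_n=\alpha_0+\delta n$, $n\in\mathbb{Z}$; these $\alpha_n$ depend on $L$. Rational integers are the elements of $\mathbb{Z}$. Divisibility and relative primality of Gaussian integers are in $\mathbb{Z}[i]$.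
   Formalization: The Gaussian integers μ_1,…,μ_k are assumed to be nonzero; if some μ_j = 0, the line must pass through 0, and only the real and imaginary axes are primitive, so the claim fails. *)

theory Defs
  imports "HOL-Analysis.Analysis"
begin

text \<open>Gaussian integers are kept as a subset of the complex plane. Divisibility has to be
  relativised to this subset, because the library relation \<open>dvd\<close> on the field of complex
  numbers is trivial.\<close>

definition gauss_ints :: "complex set" where
  "gauss_ints = {z. Re z \<in> \<int> \<and> Im z \<in> \<int>}"

definition gauss_dvd :: "complex \<Rightarrow> complex \<Rightarrow> bool" (infix "gdvd" 50) where
  "a gdvd b \<longleftrightarrow> (\<exists>c\<in>gauss_ints. b = a * c)"

definition gauss_unit :: "complex \<Rightarrow> bool" where
  "gauss_unit u \<longleftrightarrow> u \<in> gauss_ints \<and> u gdvd 1"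

definition gauss_coprime :: "complex \<Rightarrow> complex \<Rightarrow> bool" where
  "gauss_coprime a b \<longleftrightarrow> (\<forall>d\<in>gauss_ints. d gdvd a \<and> d gdvd b \<longrightarrow> gauss_unit d)"

definition gauss_norm :: "complex \<Rightarrow> real" where
  "gauss_norm z = (Re z)\<^sup>2 + (Im z)\<^sup>2"

definition gaussian_line :: "complex set \<Rightarrow> bool" where
  "gaussian_line L \<longleftrightarrow> affine L \<and> aff_dim L = 1 \<and>
     (\<exists>z\<in>L \<inter> gauss_ints. \<exists>w\<in>L \<inter> gauss_ints. z \<noteq> w)"

definition primitive_gaussian_line :: "complex set \<Rightarrow> bool" where
  "primitive_gaussian_line L \<longleftrightarrow> gaussian_line L \<and>
     \<not> (\<exists>d\<in>gauss_ints. \<not> gauss_unit d \<and> (\<forall>z\<in>L \<inter> gauss_ints. d gdvd z))"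

definition vertical :: "complex set \<Rightarrow> bool" where
  "vertical L \<longleftrightarrow> (\<forall>z\<in>L. \<forall>w\<in>L. Re z = Re w)"

text \<open>The description below is unique for a Gaussian line: two distinct Gaussian integers of
  minimum norm on it are mirror images in the foot of the perpendicular from 0, so they can share
  their real part only if the line is vertical; but a vertical Gaussian line meets the real axis
  in a Gaussian integer, which is then the only one of minimum norm.\<close>

definition line_alpha0 :: "complex set \<Rightarrow> complex" where
  "line_alpha0 L = (THE z. z \<in> L \<inter> gauss_ints \<and>
     (\<forall>w\<in>L \<inter> gauss_ints. gauss_norm z \<le> gauss_norm w \<and>
        (gauss_norm w = gauss_norm z \<longrightarrow> Re w \<le> Re z)))"

text \<open>Only meaningful for lines that are not vertical.\<close>

definition line_alpha1 :: "complex set \<Rightarrow> complex" where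
  "line_alpha1 L = (THE z. z \<in> L \<inter> gauss_ints \<and> Re z > Re (line_alpha0 L) \<and>
     (\<forall>w\<in>L \<inter> gauss_ints. Re w > Re (line_alpha0 L) \<longrightarrow>
        dist z (line_alpha0 L) \<le> dist w (line_alpha0 L)))"

definition line_delta :: "complex set \<Rightarrow> complex" where
  "line_delta L = (if vertical L then \<i> else line_alpha1 L - line_alpha0 L)"

definition line_alpha :: "complex set \<Rightarrow> int \<Rightarrow> complex" where
  "line_alpha L n = line_alpha0 L + line_delta L * of_int n"

end

theory Submission imports Defs
begin

text \<open>By the Chinese remainder theorem in \<open>\<int>[\<i>]\<close> there is \<open>\<beta> \<noteq> 0\<close> with \<open>\<mu>\<^sub>j\<close> dividing \<open>\<beta> + b\<^sub>j\<close> for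
  all \<open>j\<close>. Let \<open>N\<close> be the norm of \<open>\<beta> \<mu>\<^sub>1 \<cdots> \<mu>\<^sub>k\<close>, and for \<open>n \<ge> 3\<close> consider the line through \<open>\<beta>\<close> with
  direction \<open>\<delta> = 1 + \<i>Nn\<close>. As \<open>Re \<delta> = 1\<close>, its Gaussian integers are exactly the \<open>\<beta> + t\<delta>\<close> with
  \<open>t\<close> an integer, and \<open>|\<delta>| > 2|\<beta>|\<close> makes \<open>\<beta>\<close> the one of minimum norm, so \<open>\<alpha>\<^sub>t = \<beta> + t\<delta>\<close>.
  Since \<open>\<delta> \<equiv> 1\<close> modulo \<open>\<beta>\<close> and modulo every \<open>\<mu>\<^sub>j\<close>, the line is primitive and \<open>\<mu>\<^sub>j\<close> divides \<open>\<alpha>\<^bsub>b\<^sub>j\<^esub>\<close>.\<close>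

section \<open>Arithmetic of the Gaussian integers\<close>

lemma gauss_ints_add [intro, simp]:
  "x \<in> gauss_ints \<Longrightarrow> y \<in> gauss_ints \<Longrightarrow> x + y \<in> gauss_ints"
  and gauss_ints_diff [intro, simp]:
  "x \<in> gauss_ints \<Longrightarrow> y \<in> gauss_ints \<Longrightarrow> x - y \<in> gauss_ints"
  and gauss_ints_mult [intro, simp]:
  "x \<in> gauss_ints \<Longrightarrow> y \<in> gauss_ints \<Longrightarrow> x * y \<in> gauss_ints"
  and gauss_ints_uminus [intro, simp]: "x \<in> gauss_ints \<Longrightarrow> - x \<in> gauss_ints"
  and gauss_ints_cnj [intro, simp]: "x \<in> gauss_ints \<Longrightarrow> cnj x \<in> gauss_ints"
  and gauss_ints_of_int [intro, simp]: "of_int m \<in> gauss_ints"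
  and gauss_ints_of_nat [intro, simp]: "of_nat l \<in> gauss_ints"
  and gauss_ints_numeral [intro, simp]: "numeral w \<in> gauss_ints"
  and gauss_ints_0 [intro, simp]: "0 \<in> gauss_ints"
  and gauss_ints_1 [intro, simp]: "1 \<in> gauss_ints"
  and gauss_ints_ii [intro, simp]: "\<i> \<in> gauss_ints"
  by (auto simp: gauss_ints_def)

lemma gauss_ints_prod [intro]:
  "(\<And>j. j \<in> F \<Longrightarrow> f j \<in> gauss_ints) \<Longrightarrow> prod f F \<in> gauss_ints"
  by (induction F rule: infinite_finite_induct) auto

lemma gdvd_add: "d gdvd x \<Longrightarrow> d gdvd y \<Longrightarrow> d gdvd x + y"
  unfolding gauss_dvd_def by (metis distrib_left gauss_ints_add)

lemma gdvd_diff: "d gdvd x \<Longrightarrow> d gdvd y \<Longrightarrow> d gdvd x - y"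
  unfolding gauss_dvd_def by (metis right_diff_distrib gauss_ints_diff)

lemma gdvd_mult_right: "d gdvd x \<Longrightarrow> c \<in> gauss_ints \<Longrightarrow> d gdvd x * c"
  unfolding gauss_dvd_def by (metis mult.assoc gauss_ints_mult)

lemma gdvd_mult_left: "d gdvd x \<Longrightarrow> c \<in> gauss_ints \<Longrightarrow> d gdvd c * x"
  by (metis gdvd_mult_right mult.commute)

lemma gdvd_refl: "d gdvd d"
  unfolding gauss_dvd_def by (intro bexI[of _ 1]) auto

lemma gdvd_trans: "a gdvd b \<Longrightarrow> b gdvd c \<Longrightarrow> a gdvd c"
  unfolding gauss_dvd_def by (metis mult.assoc gauss_ints_mult)

lemma gdvd_prod:
  assumes "finite F" "j \<in> F" "\<And>i. i \<in> F \<Longrightarrow> f i \<in> gauss_ints"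
  shows "f j gdvd prod f F"
proof -
  have "prod f (F - {j}) \<in> gauss_ints"
    using assms by blast
  then show ?thesis
    unfolding gauss_dvd_def using prod.remove[OF assms(1,2)] by blast
qed

section \<open>Norm and division with remainder\<close>

lemma gauss_norm_conv_norm: "gauss_norm z = (norm z)\<^sup>2"
  by (simp add: gauss_norm_def cmod_power2)

lemma gauss_norm_less_iff: "gauss_norm z < gauss_norm w \<longleftrightarrow> norm z < norm w"
  unfolding gauss_norm_conv_norm by (auto intro: power_strict_mono power2_less_imp_less)

lemma gauss_normE:
  assumes "z \<in> gauss_ints"
  obtains m :: int where "gauss_norm z = of_int m"
proof -
  have "gauss_norm z \<in> \<int>"
    using assms by (auto simp: gauss_ints_def gauss_norm_def)
  then show ?thesis
    using that by (rule Ints_cases)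
qed

text \<open>Round both coordinates of the quotient \<open>x / y\<close>. Each is off by at most 1/2,
  so the rounding error has squared modulus at most 1/4 + 1/4 < 1; multiplying back by
  \<open>y\<close> scales it to less than \<open>norm y\<close>.\<close>

lemma gauss_division:
  assumes "y \<noteq> 0"
  obtains q where "q \<in> gauss_ints" "norm (x - q * y) < norm y"
proof -
  define z where "z = x / y"
  define q where "q = Complex (of_int (round (Re z))) (of_int (round (Im z)))"
  have "\<bar>Re (z - q)\<bar> \<le> 1/2" "\<bar>Im (z - q)\<bar> \<le> 1/2"
    using of_int_round_abs_le[of "Re z"] of_int_round_abs_le[of "Im z"]
    by (auto simp: q_def abs_minus_commute)
  then have "(Re (z - q))\<^sup>2 \<le> (1/2)\<^sup>2" "(Im (z - q))\<^sup>2 \<le> (1/2)\<^sup>2"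
    by (metis power2_abs power_mono abs_ge_zero)+
  then have "(norm (z - q))\<^sup>2 < 1\<^sup>2"
    by (simp only: cmod_power2) (simp add: power2_eq_square)
  then have less1: "norm (z - q) < 1"
    using power2_less_imp_less by fastforce
  have "x - q * y = (z - q) * y"
    using assms by (simp add: z_def field_simps)
  then have "norm (x - q * y) = norm (z - q) * norm y"
    by (simp add: norm_mult)
  also have "\<dots> < norm y"
    using less1 assms by simp
  finally show ?thesis
    using that[of q] by (auto simp: q_def gauss_ints_def)
qed

section \<open>Bezout identities and the Chinese remainder theorem\<close>

definition gauss_bezout :: "complex \<Rightarrow> complex \<Rightarrow> bool" where
  "gauss_bezout x y \<longleftrightarrow> (\<exists>u\<in>gauss_ints. \<exists>v\<in>gauss_ints. u * x + v * y = 1)"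

text \<open>Euclid's argument in the ideal \<open>I\<close> generated by \<open>x\<close> and
  \<open>y\<close>: a nonzero element \<open>d\<close> of least norm divides all of
  \<open>I\<close>, since the remainder lies in \<open>I\<close> and is smaller. So \<open>d\<close>
  divides \<open>x\<close> and \<open>y\<close>, is a unit by coprimality, and multiplying its
  representation by its inverse yields 1.\<close>

lemma gauss_coprime_imp_bezout:
  assumes x: "x \<in> gauss_ints" "x \<noteq> 0" and y: "y \<in> gauss_ints"
    and cop: "gauss_coprime x y"
  shows "gauss_bezout x y"
proof -
  define I where "I = {u * x + v * y | u v. u \<in> gauss_ints \<and> v \<in> gauss_ints}"
  have I_comb: "z - q * d \<in> I" if "z \<in> I" "d \<in> I" "q \<in> gauss_ints" for z d q
  proof -
    obtain u v u' v' where uv: "z = u * x + v * y" "d = u' * x + v' * y"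
      "u \<in> gauss_ints" "v \<in> gauss_ints" "u' \<in> gauss_ints" "v' \<in> gauss_ints"
      using \<open>z \<in> I\<close> \<open>d \<in> I\<close> by (auto simp: I_def)
    have "z - q * d = (u - q * u') * x + (v - q * v') * y"
      by (simp add: uv algebra_simps)
    then show ?thesis
      unfolding I_def using uv that(3) by blast
  qed
  have "x = 1 * x + 0 * y" "y = 0 * x + 1 * y"
    by auto
  then have xI: "x \<in> I" and yI: "y \<in> I"
    unfolding I_def by blast+
  have I_gauss: "z \<in> gauss_ints" if "z \<in> I" for z
    using that x y by (auto simp: I_def)
  \<comment> \<open>A measure in the natural numbers, so that a least value exists. The floor loses
    nothing on \<open>I\<close>, where the norm is a nonnegative integer.\<close>
  define m where "m z = nat \<lfloor>gauss_norm z\<rfloor>" for z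
  have m_less: "m z < m w" if zw: "norm z < norm w" "z \<in> I" "w \<in> I" for z w
  proof -
    obtain a where a: "gauss_norm z = of_int a"
      using gauss_normE I_gauss[OF zw(2)] .
    obtain b where b: "gauss_norm w = of_int b"
      using gauss_normE I_gauss[OF zw(3)] .
    have "real_of_int a < of_int b" "0 \<le> real_of_int a"
      using zw(1) gauss_norm_less_iff[of z w] unfolding a[symmetric] b[symmetric]
      by (simp_all add: gauss_norm_conv_norm)
    then show ?thesis
      by (simp add: m_def a b)
  qed
  obtain d where d: "d \<in> I" "d \<noteq> 0" and least: "\<And>z. z \<in> I \<Longrightarrow> z \<noteq> 0 \<Longrightarrow> m d \<le> m z"
    using exists_least_iff[of "\<lambda>l. \<exists>z. z \<in> I \<and> z \<noteq> 0 \<and> l = m z"] xI x(2)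
    by (metis not_le)
  have dvd: "d gdvd z" if "z \<in> I" for z
  proof -
    obtain q where q: "q \<in> gauss_ints" "norm (z - q * d) < norm d"
      using gauss_division[OF d(2)] .
    have "z - q * d \<in> I"
      using I_comb that d(1) q(1) by blast
    then have "z - q * d = 0"
      using least m_less[OF q(2)] d(1) by (meson not_le)
    then show ?thesis
      unfolding gauss_dvd_def using q(1) by (auto simp: mult.commute)
  qed
  have "gauss_unit d"
    using cop dvd xI yI I_gauss d(1) unfolding gauss_coprime_def by blast
  then obtain c where c: "c \<in> gauss_ints" "1 = d * c"
    by (auto simp: gauss_unit_def gauss_dvd_def)
  obtain u v where uv: "d = u * x + v * y" "u \<in> gauss_ints" "v \<in> gauss_ints"
    using d(1) by (auto simp: I_def)
  have "(c * u) * x + (c * v) * y = 1"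
    unfolding c(2) uv(1) by (simp add: algebra_simps)
  then show ?thesis
    unfolding gauss_bezout_def using c(1) uv by blast
qed

text \<open>Multiply the two identities: every term of the product except
  \<open>(u * u') * (x * y)\<close> contains the factor \<open>z\<close>. This is the step by which
  pairwise coprimality passes to products of moduli.\<close>

lemma gauss_bezout_mult:
  assumes "gauss_bezout x z" "gauss_bezout y z"
    and "x \<in> gauss_ints" "y \<in> gauss_ints" "z \<in> gauss_ints"
  shows "gauss_bezout (x * y) z"
proof -
  obtain u v u' v' where uv: "u * x + v * z = 1" "u' * y + v' * z = 1"
    "u \<in> gauss_ints" "v \<in> gauss_ints" "u' \<in> gauss_ints" "v' \<in> gauss_ints"
    using assms(1,2) by (auto simp: gauss_bezout_def)
  have "(u * u') * (x * y) + (u * x * v' + v * u' * y + v * v' * z) * z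
      = (u * x + v * z) * (u' * y + v' * z)"
    by (simp add: algebra_simps)
  also have "\<dots> = 1"
    using uv by simp
  finally show ?thesis
    unfolding gauss_bezout_def using uv assms(3-5) by blast
qed

lemma gauss_bezout_prod:
  assumes "finite F" "z \<in> gauss_ints"
    and "\<And>j. j \<in> F \<Longrightarrow> f j \<in> gauss_ints" "\<And>j. j \<in> F \<Longrightarrow> gauss_bezout (f j) z"
  shows "gauss_bezout (prod f F) z"
  using assms(1,3,4)
proof (induction F)
  case empty
  have "1 * 1 + 0 * z = 1"
    by simp
  then show ?case
    unfolding gauss_bezout_def prod.empty by blast
next
  case (insert a F)
  then show ?case
    using gauss_bezout_mult[of "f a" z "prod f F"] assms(2) gauss_ints_prod[of F f] by auto
qed

lemma gauss_chinese_remainder: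
  assumes "finite F"
    and "\<And>j. j \<in> F \<Longrightarrow> \<mu> j \<in> gauss_ints" "\<And>j. j \<in> F \<Longrightarrow> c j \<in> gauss_ints"
    and "\<And>i j. i \<in> F \<Longrightarrow> j \<in> F \<Longrightarrow> i \<noteq> j \<Longrightarrow> gauss_bezout (\<mu> i) (\<mu> j)"
  shows "\<exists>x\<in>gauss_ints. \<forall>j\<in>F. \<mu> j gdvd x - c j"
  using assms
proof (induction F)
  case empty
  then show ?case by blast
next
  case (insert a F)
  then obtain x where x: "x \<in> gauss_ints" "\<And>j. j \<in> F \<Longrightarrow> \<mu> j gdvd x - c j"
    by auto
  define M where "M = prod \<mu> F"
  have M: "M \<in> gauss_ints"
    unfolding M_def using insert.prems by auto
  have "gauss_bezout M (\<mu> a)"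
    unfolding M_def using insert by (intro gauss_bezout_prod) auto
  then obtain u v where uv: "u \<in> gauss_ints" "v \<in> gauss_ints" "u * M + v * \<mu> a = 1"
    by (auto simp: gauss_bezout_def)
  have c: "c a \<in> gauss_ints" and a: "\<mu> a \<in> gauss_ints"
    using insert.prems by auto
  \<comment> \<open>By the Bezout identity, \<open>v * \<mu> a\<close> is 1 modulo \<open>M\<close>
    and 0 modulo \<open>\<mu> a\<close>, while \<open>u * M\<close> is the reverse. The combination
    therefore keeps the old residues of \<open>x\<close> and acquires the residue
    \<open>c a\<close>.\<close>
  define x' where "x' = x * (v * \<mu> a) + c a * (u * M)"
  have "\<mu> j gdvd x' - c j" if "j \<in> insert a F" for j
  proof (cases "j = a")
    case True
    have "x' - c a = x * (v * \<mu> a) - c a * (1 - u * M)"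
      by (simp add: x'_def algebra_simps)
    also have "1 - u * M = v * \<mu> a"
      using uv(3) by (simp add: algebra_simps)
    also have "x * (v * \<mu> a) - c a * (v * \<mu> a) = \<mu> a * (v * (x - c a))"
      by (simp add: algebra_simps)
    finally show ?thesis
      unfolding True gauss_dvd_def using uv x(1) c by blast
  next
    case False
    then have j: "j \<in> F"
      using that by simp
    have "\<mu> j gdvd M"
      unfolding M_def using insert j by (intro gdvd_prod) auto
    then have "\<mu> j gdvd M * (u * (c a - x))"
      using uv x(1) c by (intro gdvd_mult_right) auto
    moreover have "x' - c j = (x - c j) + M * (u * (c a - x))"
    proof -
      have v: "v * \<mu> a = 1 - u * M"
        using uv(3) by (simp add: algebra_simps)
      show ?thesis
        unfolding x'_def v by (simp add: algebra_simps)
    qed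
    ultimately show ?thesis
      using gdvd_add[OF x(2)[OF j]] by (simp only:)
  qed
  moreover have "x' \<in> gauss_ints"
    using x(1) uv M c a by (simp add: x'_def)
  ultimately show ?case
    by blast
qed

section \<open>Lines whose direction has real part one\<close>

definition dir_line :: "complex \<Rightarrow> complex \<Rightarrow> complex set" where
  "dir_line \<beta> \<delta> = range (\<lambda>t::real. \<beta> + of_real t * \<delta>)"

lemma dir_line_eq_affine_hull: "dir_line \<beta> \<delta> = affine hull {\<beta>, \<beta> + \<delta>}"
  by (simp add: dir_line_def affine_hull_2_alt scaleR_conv_of_real)

context
  fixes \<beta> \<delta> :: complex
  assumes \<beta>: "\<beta> \<in> gauss_ints" and \<delta>: "\<delta> \<in> gauss_ints" and Re_\<delta>: "Re \<delta> = 1"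
begin

text \<open>Because \<open>Re \<delta> = 1\<close>, the parameter of a point \<open>z\<close> is
  \<open>Re (z - \<beta>)\<close>, which is an integer as soon as \<open>z\<close> is a Gaussian
  integer.\<close>

lemma dir_line_gauss_ints: "dir_line \<beta> \<delta> \<inter> gauss_ints = range (\<lambda>t::int. \<beta> + of_int t * \<delta>)"
proof
  show "dir_line \<beta> \<delta> \<inter> gauss_ints \<subseteq> range (\<lambda>t::int. \<beta> + of_int t * \<delta>)"
  proof
    fix z assume "z \<in> dir_line \<beta> \<delta> \<inter> gauss_ints"
    then obtain t :: real where t: "z = \<beta> + of_real t * \<delta>" and z: "z \<in> gauss_ints"
      by (auto simp: dir_line_def)
    have "t = Re (z - \<beta>)"
      by (simp add: t Re_\<delta>)
    also have "\<dots> \<in> \<int>"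
      using z \<beta> by (simp add: gauss_ints_def)
    finally obtain s :: int where "t = of_int s"
      by (auto elim: Ints_cases)
    then show "z \<in> range (\<lambda>t::int. \<beta> + of_int t * \<delta>)"
      unfolding t by (intro range_eqI[of _ _ s]) simp
  qed
next
  have "\<beta> + of_int t * \<delta> \<in> dir_line \<beta> \<delta>" for t
    unfolding dir_line_def by (rule range_eqI[of _ _ "of_int t"]) simp
  then show "range (\<lambda>t::int. \<beta> + of_int t * \<delta>) \<subseteq> dir_line \<beta> \<delta> \<inter> gauss_ints"
    using \<beta> \<delta> by auto
qed

lemma in_dir_line: "\<beta> + of_int t * \<delta> \<in> dir_line \<beta> \<delta> \<inter> gauss_ints"
  using dir_line_gauss_ints by blast

lemma base_in_dir_line: "\<beta> \<in> dir_line \<beta> \<delta> \<inter> gauss_ints"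
  using in_dir_line[of 0] by simp

lemma base_add_in_dir_line: "\<beta> + \<delta> \<in> dir_line \<beta> \<delta> \<inter> gauss_ints"
  using in_dir_line[of 1] by simp

lemma gaussian_line_dir_line: "gaussian_line (dir_line \<beta> \<delta>)"
proof -
  have ne: "\<beta> \<noteq> \<beta> + \<delta>"
    using Re_\<delta> by auto
  then have "aff_dim (dir_line \<beta> \<delta>) = 1"
    by (simp add: dir_line_eq_affine_hull)
  moreover have "affine (dir_line \<beta> \<delta>)"
    by (simp add: dir_line_eq_affine_hull)
  ultimately show ?thesis
    unfolding gaussian_line_def using ne base_in_dir_line base_add_in_dir_line by blast
qed

text \<open>A common divisor divides \<open>\<beta>\<close> and \<open>\<beta> + \<delta>\<close>,
  hence \<open>\<delta>\<close>; through \<open>\<beta>\<close> it also divides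
  \<open>\<delta> - 1\<close>, and so it divides 1.\<close>

lemma primitive_dir_line:
  assumes "\<beta> gdvd \<delta> - 1"
  shows "primitive_gaussian_line (dir_line \<beta> \<delta>)"
proof -
  have "gauss_unit d" if d: "d \<in> gauss_ints" "\<And>z. z \<in> dir_line \<beta> \<delta> \<inter> gauss_ints \<Longrightarrow> d gdvd z" for d
  proof -
    have d\<beta>: "d gdvd \<beta>" and "d gdvd \<beta> + \<delta>"
      using d(2) base_in_dir_line base_add_in_dir_line by auto
    then have "d gdvd \<delta>"
      using gdvd_diff[of d "\<beta> + \<delta>" \<beta>] by simp
    moreover have "d gdvd \<delta> - 1"
      using gdvd_trans[OF d\<beta> assms] .
    ultimately show ?thesis
      using gdvd_diff[of d \<delta> "\<delta> - 1"] d(1) by (simp add: gauss_unit_def)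
  qed
  then show ?thesis
    unfolding primitive_gaussian_line_def using gaussian_line_dir_line by blast
qed

section \<open>Minimum norm and indexing along the line\<close>

context
  assumes large: "norm \<delta> > 2 * norm \<beta>"
begin

text \<open>For \<open>t \<noteq> 0\<close> the triangle inequality gives \<open>norm w \<ge> norm
  (of_int t * \<delta>) - norm \<beta> \<ge> norm \<delta> - norm \<beta> > norm \<beta>\<close>. As
  the minimum is strict, the tie-break by real part never has to decide.\<close>

lemma norm_base_less:
  assumes "w \<in> dir_line \<beta> \<delta> \<inter> gauss_ints" "w \<noteq> \<beta>"
  shows "gauss_norm \<beta> < gauss_norm w"
proof -
  obtain t :: int where t: "w = \<beta> + of_int t * \<delta>"
    using assms(1) dir_line_gauss_ints by auto
  have "1 \<le> \<bar>t\<bar>"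
    using assms(2) t by auto
  then have "1 * norm \<delta> \<le> norm (of_int t * \<delta>)"
    unfolding norm_mult norm_of_int by (intro mult_right_mono) auto
  moreover have "norm (of_int t * \<delta>) \<le> norm w + norm \<beta>"
    using norm_triangle_ineq4[of w \<beta>] by (simp add: t)
  ultimately show ?thesis
    using large by (simp add: gauss_norm_less_iff)
qed

lemma line_alpha0_dir_line: "line_alpha0 (dir_line \<beta> \<delta>) = \<beta>"
  unfolding line_alpha0_def
proof (rule the_equality)
  show "\<beta> \<in> dir_line \<beta> \<delta> \<inter> gauss_ints \<and>
    (\<forall>w\<in>dir_line \<beta> \<delta> \<inter> gauss_ints. gauss_norm \<beta> \<le> gauss_norm w \<and>
      (gauss_norm w = gauss_norm \<beta> \<longrightarrow> Re w \<le> Re \<beta>))"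
    using base_in_dir_line norm_base_less by (metis less_irrefl less_imp_le order_refl)
next
  fix z assume "z \<in> dir_line \<beta> \<delta> \<inter> gauss_ints \<and>
    (\<forall>w\<in>dir_line \<beta> \<delta> \<inter> gauss_ints. gauss_norm z \<le> gauss_norm w \<and>
      (gauss_norm w = gauss_norm z \<longrightarrow> Re w \<le> Re z))"
  then show "z = \<beta>"
    using base_in_dir_line norm_base_less by (meson not_le)
qed

text \<open>A larger real part means \<open>t \<ge> 1\<close>, and the distance to
  \<open>\<beta>\<close> is then \<open>t * norm \<delta>\<close>, smallest only at
  \<open>t = 1\<close>.\<close>

lemma line_alpha1_dir_line: "line_alpha1 (dir_line \<beta> \<delta>) = \<beta> + \<delta>"
proof -
  have far: "dist (\<beta> + \<delta>) \<beta> < dist w \<beta>"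
    if w: "w \<in> dir_line \<beta> \<delta> \<inter> gauss_ints" "Re w > Re \<beta>" "w \<noteq> \<beta> + \<delta>" for w
  proof -
    obtain t :: int where t: "w = \<beta> + of_int t * \<delta>"
      using w(1) unfolding dir_line_gauss_ints by blast
    have "t > 0" "t \<noteq> 1"
      using w(2,3) by (auto simp: t Re_\<delta>)
    then have "1 < \<bar>t\<bar>"
      by simp
    moreover have "norm \<delta> > 0"
      using Re_\<delta> by auto
    ultimately have "1 * norm \<delta> < norm (of_int t * \<delta>)"
      unfolding norm_mult norm_of_int by (intro mult_strict_right_mono) auto
    then show ?thesis
      by (simp add: dist_norm t)
  qed
  show ?thesis
    unfolding line_alpha1_def line_alpha0_dir_line
  proof (rule the_equality)
    show "\<beta> + \<delta> \<in> dir_line \<beta> \<delta> \<inter> gauss_ints \<and> Re \<beta> < Re (\<beta> + \<delta>) \<and>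
      (\<forall>w\<in>dir_line \<beta> \<delta> \<inter> gauss_ints. Re \<beta> < Re w \<longrightarrow> dist (\<beta> + \<delta>) \<beta> \<le> dist w \<beta>)"
    proof (intro conjI ballI impI)
      fix w assume "w \<in> dir_line \<beta> \<delta> \<inter> gauss_ints" "Re \<beta> < Re w"
      then show "dist (\<beta> + \<delta>) \<beta> \<le> dist w \<beta>"
        using far[of w] by (cases "w = \<beta> + \<delta>") auto
    qed (use base_add_in_dir_line Re_\<delta> in auto)
  next
    fix z assume z: "z \<in> dir_line \<beta> \<delta> \<inter> gauss_ints \<and> Re \<beta> < Re z \<and>
      (\<forall>w\<in>dir_line \<beta> \<delta> \<inter> gauss_ints. Re \<beta> < Re w \<longrightarrow> dist z \<beta> \<le> dist w \<beta>)"
    have "dist z \<beta> \<le> dist (\<beta> + \<delta>) \<beta>"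
      using z base_add_in_dir_line Re_\<delta> by simp
    then show "z = \<beta> + \<delta>"
      using far z by (meson not_le)
  qed
qed

lemma line_alpha_dir_line: "line_alpha (dir_line \<beta> \<delta>) t = \<beta> + \<delta> * of_int t"
proof -
  have "Re \<beta> \<noteq> Re (\<beta> + \<delta>)"
    by (simp add: Re_\<delta>)
  then have "\<not> vertical (dir_line \<beta> \<delta>)"
    unfolding vertical_def using base_in_dir_line base_add_in_dir_line by blast
  then show ?thesis
    by (simp add: line_alpha_def line_delta_def line_alpha0_dir_line line_alpha1_dir_line)
qed

end

end

text \<open>The point \<open>\<beta> + \<delta>\<close> lies on the second line too, so
  \<open>\<delta>\<close> is a real multiple of \<open>\<delta>'\<close>; equal real parts force the
  factor 1.\<close>

lemma dir_line_eqD: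
  assumes "dir_line \<beta> \<delta> = dir_line \<beta> \<delta>'" "Re \<delta> = 1" "Re \<delta>' = 1"
  shows "\<delta> = \<delta>'"
proof -
  have "\<beta> + of_real 1 * \<delta> \<in> dir_line \<beta> \<delta>"
    unfolding dir_line_def by blast
  then have "\<beta> + of_real 1 * \<delta> \<in> dir_line \<beta> \<delta>'"
    unfolding assms(1) .
  then obtain t :: real where t: "\<delta> = of_real t * \<delta>'"
    unfolding dir_line_def image_def by auto
  then have "Re \<delta> = t * Re \<delta>'"
    by simp
  then show ?thesis
    using t assms(2,3) by simp
qed

section \<open>The infinite family of lines through a common base point\<close>

theorem theorem9:
  fixes k :: nat and b :: "nat \<Rightarrow> int" and \<mu> :: "nat \<Rightarrow> complex"
  assumes "\<forall>j\<in>{1..k}. \<mu> j \<in> gauss_ints"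
    and "\<forall>j\<in>{1..k}. \<mu> j \<noteq> 0"
    and "\<forall>i\<in>{1..k}. \<forall>j\<in>{1..k}. i \<noteq> j \<longrightarrow> gauss_coprime (\<mu> i) (\<mu> j)"
  shows "infinite {L. primitive_gaussian_line L \<and>
           (\<forall>j\<in>{1..k}. \<mu> j gdvd line_alpha L (b j))}"
proof -
  define M where "M = prod \<mu> {1..k}"
  have M: "M \<in> gauss_ints" "M \<noteq> 0"
    using assms(1,2) by (auto simp: M_def)
  have \<mu>_dvd_M: "\<mu> j gdvd M" if "j \<in> {1..k}" for j
    unfolding M_def using assms(1) that by (intro gdvd_prod) auto
  \<comment> \<open>The residue is \<open>- b j\<close> because the direction will be 1 modulo
    \<open>\<mu> j\<close>, which makes the point with index \<open>b j\<close> congruent to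
    \<open>\<beta> + b j\<close>.\<close>
  have "\<exists>x\<in>gauss_ints. \<forall>j\<in>{1..k}. \<mu> j gdvd x - (- of_int (b j))"
    using assms by (intro gauss_chinese_remainder gauss_coprime_imp_bezout) auto
  then obtain x where x: "x \<in> gauss_ints" "\<And>j. j \<in> {1..k} \<Longrightarrow> \<mu> j gdvd x + of_int (b j)"
    by auto
  \<comment> \<open>Replacing 0 by \<open>M\<close> changes no residue modulo any
    \<open>\<mu> j\<close>. A nonzero base point makes \<open>N\<close> positive and the norm bound
    below strict.\<close>
  define \<beta> where "\<beta> = (if x = 0 then M else x)"
  have \<beta>: "\<beta> \<in> gauss_ints" "\<beta> \<noteq> 0"
    using x M by (auto simp: \<beta>_def)
  have \<mu>_dvd: "\<mu> j gdvd \<beta> + of_int (b j)" if "j \<in> {1..k}" for j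
    using x(2)[OF that] gdvd_add[OF \<mu>_dvd_M[OF that] x(2)[OF that]] by (auto simp: \<beta>_def)
  \<comment> \<open>Multiplying by the conjugate gives a real multiple of both
    \<open>\<beta>\<close> and \<open>M\<close>, so adding \<open>\<i>\<close> times integer
    multiples of it to 1 leaves the real part equal to 1.\<close>
  define N where "N = (\<beta> * M) * cnj (\<beta> * M)"
  have N: "N \<in> gauss_ints" "\<beta> gdvd N" "M gdvd N"
  proof -
    show "N \<in> gauss_ints"
      using \<beta> M by (simp add: N_def)
    show "\<beta> gdvd N" "M gdvd N"
      using \<beta> M unfolding N_def
      by (auto intro!: gdvd_mult_right[OF gdvd_mult_right[OF gdvd_refl]]
          gdvd_mult_right[OF gdvd_mult_left[OF gdvd_refl]])
  qed
  have N_real: "N = of_real ((norm (\<beta> * M))\<^sup>2)"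
    by (simp only: N_def complex_norm_square)
  have one_le: "1 \<le> norm z" if "z \<in> gauss_ints" "z \<noteq> 0" for z
  proof -
    obtain m where m: "gauss_norm z = of_int m"
      using gauss_normE \<open>z \<in> gauss_ints\<close> .
    moreover have "0 < gauss_norm z"
      using \<open>z \<noteq> 0\<close> by (simp add: gauss_norm_conv_norm)
    ultimately have "1 \<le> (norm z)\<^sup>2"
      by (simp add: gauss_norm_conv_norm)
    then show ?thesis
      using power2_le_imp_le[of 1 "norm z"] by simp
  qed
  \<comment> \<open>Nonzero Gaussian integers have modulus at least 1, so neither the factor
    \<open>M\<close> nor squaring makes the value smaller.\<close>
  have "norm \<beta> * 1 \<le> norm \<beta> * norm M"
    using one_le[OF M] by (intro mult_left_mono) auto
  also have "\<dots> \<le> (norm (\<beta> * M))\<^sup>2"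
    using self_le_power[of "norm (\<beta> * M)" 2] one_le[of "\<beta> * M"] \<beta> M by (simp add: norm_mult)
  finally have N_ge: "norm \<beta> \<le> Re N"
    by (simp add: N_real)
  \<comment> \<open>The offset 3 lets \<open>n\<close> range over all natural numbers: already at
    \<open>n = 0\<close> the imaginary part is at least \<open>3 * norm \<beta>\<close>, above the
    required \<open>2 * norm \<beta>\<close>.\<close>
  define \<delta> where "\<delta> n = 1 + N * (\<i> * of_int (int n + 3))" for n
  have Re_\<delta>: "Re (\<delta> n) = 1" and Im_\<delta>: "Im (\<delta> n) = Re N * (real n + 3)" for n
    by (simp_all add: \<delta>_def N_real)
  have \<delta>: "\<delta> n \<in> gauss_ints" for n
    using N unfolding \<delta>_def by (intro gauss_ints_add gauss_ints_mult) auto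
  have large: "norm (\<delta> n) > 2 * norm \<beta>" for n
  proof -
    have "2 * norm \<beta> < norm \<beta> * 3"
      using \<beta>(2) by simp
    also have "\<dots> \<le> Re N * (real n + 3)"
      using N_ge by (intro mult_mono) (auto simp: N_real)
    also have "\<dots> \<le> norm (\<delta> n)"
      using abs_Im_le_cmod[of "\<delta> n"] by (simp add: Im_\<delta>)
    finally show ?thesis .
  qed
  have "primitive_gaussian_line (dir_line \<beta> (\<delta> n))" for n
  proof (rule primitive_dir_line[OF \<beta>(1) \<delta> Re_\<delta>])
    show "\<beta> gdvd \<delta> n - 1"
      using N(2) unfolding \<delta>_def by (auto intro!: gdvd_mult_right)
  qed
  moreover have "\<mu> j gdvd line_alpha (dir_line \<beta> (\<delta> n)) (b j)" if j: "j \<in> {1..k}" for n j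
  proof -
    \<comment> \<open>This is \<open>(\<delta> n - 1) * b j\<close>, the difference between the
      point with index \<open>b j\<close> and \<open>\<beta> + b j\<close>.\<close>
    have "\<mu> j gdvd N * (\<i> * of_int (int n + 3) * of_int (b j))"
      by (intro gdvd_mult_right[OF gdvd_trans[OF \<mu>_dvd_M[OF j] N(3)]] gauss_ints_mult) auto
    then have "\<mu> j gdvd (\<beta> + of_int (b j)) + N * (\<i> * of_int (int n + 3) * of_int (b j))"
      using \<mu>_dvd[OF j] gdvd_add by blast
    also have "\<dots> = \<beta> + \<delta> n * of_int (b j)"
      by (simp add: \<delta>_def algebra_simps)
    finally show ?thesis
      by (simp add: line_alpha_dir_line[OF \<beta>(1) \<delta> Re_\<delta> large])
  qed
  ultimately have sub: "range (\<lambda>n. dir_line \<beta> (\<delta> n)) \<subseteq> {L. primitive_gaussian_line L \<and>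
           (\<forall>j\<in>{1..k}. \<mu> j gdvd line_alpha L (b j))}"
    by blast
  have "inj (\<lambda>n. dir_line \<beta> (\<delta> n))"
  proof (rule injI)
    fix m n assume "dir_line \<beta> (\<delta> m) = dir_line \<beta> (\<delta> n)"
    then have "\<delta> m = \<delta> n"
      using dir_line_eqD Re_\<delta> by blast
    \<comment> \<open>The imaginary parts of the directions recover the index, since
      \<open>Re N\<close> is positive.\<close>
    then have "Re N * (real m + 3) = Re N * (real n + 3)"
      using Im_\<delta> by metis
    moreover have "Re N > 0"
      using N_ge \<beta>(2) by (meson less_le_trans zero_less_norm_iff)
    ultimately show "m = n"
      by simp
  qed
  then show ?thesis
    using sub finite_subset range_inj_infinite by blast
qed

end
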